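(* Let $\varphi:(A,d_A)\to(B,d_B)$ be a dg-extension of dg-algebras, and let $\mu:B\otimes_AB\to B$ be the multiplication map. Then this extension is dg-separable if and only if there is an element $\omega\in\ker(d_{B\otimes_AB})$, homogeneous of degree $0$, with $b\omega=\omega b$ for all $b\in B$ and $\mu(\omega)=1$.
   Context: Let $K$ be a commutative ring. A differential graded $K$-algebra (dg-algebra) $(A,d)$ is a $\mathbb{Z}$-graded unital associative $K$-algebra $A$ together with a $K$-linear graded endomorphism $d:A\to A$ of degree $1$ such that $d^2=0$ and $d(ab)=d(a)b+(-1)^{|a|}a\,d(b)$ for all homogeneous $a,b\in A$. A dg-extension of dg-algebras is a homomorphism of dg-algebras $(A,d_A)\to(B,d_B)$ (a unital, degree $0$ algebra homomorphism commuting with the differentials). For a dg-extension $(A,d_A)\to(B,d_B)$, the tensor product $B\otimes_AB$ is a differential graded $B$-$B$-bimodule with differential $d_{B\otimes_AB}=d_B\otimes\mathrm{id}_B+\mathrm{id}_B\otimes d_B$, respecting the Koszul sign rule, i.e. $d_{B\otimes_AB}(b\otimes b')=d_B(b)\otimes b'+(-1)^{|b|}b\otimes d_B(b')$ for homogeneous $b,b'\in B$; the bimodule structure is $b(x\otimes y)b'=bx\otimes yb'$. The multiplication map $\mu:B\otimes_AB\to B$, $x\otimes y\mapsto xy$, is a morphism of differential graded $B$-$B$-bimodules. The dg-extension is called dg-separable if $\mu$ is split as a morphism of differential graded $B$-$B$-bimodules, i.e. there is a degree $0$ homomorphism of $B$-$B$-bimodules $\rho:B\to B\otimes_AB$ commuting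 with the differentials and with $\mu\circ\rho=\mathrm{id}_B$. *)

theory Defs
  imports "HOL-Algebra.Algebra"
begin

section \<open>Differential graded algebras\<close>

text \<open>
  Following the library's \<open>module\<close> record, the fields \<open>mult\<close> and \<open>one\<close> are meaningful for
  an algebra and are unused for a mere module.
\<close>

record ('k, 'a) dg_module = "('k, 'a) module" +
  grade :: "int \<Rightarrow> 'a set"
  diff :: "'a \<Rightarrow> 'a"

definition homogeneous_decomposition ::
    "('k, 'a, 'm) dg_module_scheme \<Rightarrow> 'a \<Rightarrow> (int \<Rightarrow> 'a) \<Rightarrow> bool" where
  "homogeneous_decomposition M a f \<longleftrightarrow>
     (\<forall>n. f n \<in> grade M n) \<and> finite {n. f n \<noteq> \<zero>\<^bsub>M\<^esub>} \<and>
     a = (\<Oplus>\<^bsub>M\<^esub>n\<in>{n. f n \<noteq> \<zero>\<^bsub>M\<^esub>}. f n)"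

definition koszul_sign :: "('k, 'a, 'm) dg_module_scheme \<Rightarrow> int \<Rightarrow> 'a \<Rightarrow> 'a" where
  "koszul_sign M n a = (if even n then a else \<ominus>\<^bsub>M\<^esub> a)"

text \<open>The library's locale \<open>algebra\<close> is about commutative algebras, hence the use of
  \<open>module\<close> and \<open>ring\<close> here.\<close>

locale dg_algebra = module K A + A?: ring A
  for K (structure) and A :: "('k, 'a, 'm) dg_module_scheme" (structure) +
  assumes smult_mult_left:
      "\<lbrakk>k \<in> carrier K; a \<in> carrier A; b \<in> carrier A\<rbrakk> \<Longrightarrow>
        (k \<odot>\<^bsub>A\<^esub> a) \<otimes>\<^bsub>A\<^esub> b = k \<odot>\<^bsub>A\<^esub> (a \<otimes>\<^bsub>A\<^esub> b)"
    and smult_mult_right: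
      "\<lbrakk>k \<in> carrier K; a \<in> carrier A; b \<in> carrier A\<rbrakk> \<Longrightarrow>
        a \<otimes>\<^bsub>A\<^esub> (k \<odot>\<^bsub>A\<^esub> b) = k \<odot>\<^bsub>A\<^esub> (a \<otimes>\<^bsub>A\<^esub> b)"
    and grade_submodule: "submodule (grade A n) K A"
    and grade_direct_sum:
      "a \<in> carrier A \<Longrightarrow> \<exists>!f. homogeneous_decomposition A a f"
    and grade_one: "\<one>\<^bsub>A\<^esub> \<in> grade A 0"
    and grade_mult:
      "\<lbrakk>a \<in> grade A m; b \<in> grade A n\<rbrakk> \<Longrightarrow> a \<otimes>\<^bsub>A\<^esub> b \<in> grade A (m + n)"
    and diff_closed: "a \<in> carrier A \<Longrightarrow> diff A a \<in> carrier A"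
    and diff_add:
      "\<lbrakk>a \<in> carrier A; b \<in> carrier A\<rbrakk> \<Longrightarrow> diff A (a \<oplus>\<^bsub>A\<^esub> b) = diff A a \<oplus>\<^bsub>A\<^esub> diff A b"
    and diff_smult:
      "\<lbrakk>k \<in> carrier K; a \<in> carrier A\<rbrakk> \<Longrightarrow> diff A (k \<odot>\<^bsub>A\<^esub> a) = k \<odot>\<^bsub>A\<^esub> diff A a"
    and diff_grade: "a \<in> grade A n \<Longrightarrow> diff A a \<in> grade A (n + 1)"
    and diff_diff: "a \<in> carrier A \<Longrightarrow> diff A (diff A a) = \<zero>\<^bsub>A\<^esub>"
    and leibniz:
      "\<lbrakk>a \<in> grade A m; b \<in> grade A n\<rbrakk> \<Longrightarrow>
        diff A (a \<otimes>\<^bsub>A\<^esub> b) = diff A a \<otimes>\<^bsub>A\<^esub> b \<oplus>\<^bsub>A\<^esub> koszul_sign A m (a \<otimes>\<^bsub>A\<^esub> diff A b)"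

locale dg_extension = A: dg_algebra K A + B: dg_algebra K B
  for K (structure)
    and A :: "('k, 'a, 'm) dg_module_scheme" (structure)
    and B :: "('k, 'b, 'n) dg_module_scheme" (structure) +
  fixes \<phi> :: "'a \<Rightarrow> 'b"
  assumes hom: "\<phi> \<in> ring_hom A B"
    and hom_smult:
      "\<lbrakk>k \<in> carrier K; a \<in> carrier A\<rbrakk> \<Longrightarrow> \<phi> (k \<odot>\<^bsub>A\<^esub> a) = k \<odot>\<^bsub>B\<^esub> \<phi> a"
    and hom_grade: "a \<in> grade A n \<Longrightarrow> \<phi> a \<in> grade B n"
    and hom_diff: "a \<in> carrier A \<Longrightarrow> \<phi> (diff A a) = diff B (\<phi> a)"

section \<open>Differential graded bimodules\<close>

record ('k, 'b, 'x) dg_bimodule = "('k, 'x) dg_module" +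
  lact :: "'b \<Rightarrow> 'x \<Rightarrow> 'x"
  ract :: "'x \<Rightarrow> 'b \<Rightarrow> 'x"

definition dg_bimodule_hom ::
    "('k, 'r) ring_scheme \<Rightarrow> ('b, 's) ring_scheme \<Rightarrow> ('k, 'b, 'x, 'm) dg_bimodule_scheme \<Rightarrow>
     ('k, 'b, 'y, 'n) dg_bimodule_scheme \<Rightarrow> ('x \<Rightarrow> 'y) set" where
  "dg_bimodule_hom K B M N =
    {f \<in> carrier M \<rightarrow> carrier N.
      (\<forall>x\<in>carrier M. \<forall>y\<in>carrier M. f (x \<oplus>\<^bsub>M\<^esub> y) = f x \<oplus>\<^bsub>N\<^esub> f y) \<and>
      (\<forall>k\<in>carrier K. \<forall>x\<in>carrier M. f (k \<odot>\<^bsub>M\<^esub> x) = k \<odot>\<^bsub>N\<^esub> f x) \<and>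
      (\<forall>b\<in>carrier B. \<forall>x\<in>carrier M. f (lact M b x) = lact N b (f x)) \<and>
      (\<forall>b\<in>carrier B. \<forall>x\<in>carrier M. f (ract M x b) = ract N (f x) b) \<and>
      (\<forall>n. \<forall>x\<in>grade M n. f x \<in> grade N n) \<and>
      (\<forall>x\<in>carrier M. f (diff M x) = diff N (f x))}"

definition regular_dg_bimodule ::
    "('k, 'b, 'n) dg_module_scheme \<Rightarrow> ('k, 'b, 'b) dg_bimodule" where
  "regular_dg_bimodule B =
    \<lparr>carrier = carrier B, monoid.mult = monoid.mult B, one = \<one>\<^bsub>B\<^esub>, ring.zero = \<zero>\<^bsub>B\<^esub>, ring.add = ring.add B,
     smult = module.smult B, grade = grade B, diff = diff B, lact = monoid.mult B, ract = monoid.mult B\<rparr>"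

section \<open>The tensor product \<open>B \<otimes>\<^sub>A B\<close>\<close>

text \<open>
  The tensor product is the quotient of the free abelian group on pairs of elements of \<open>B\<close> by
  biadditivity and \<open>A\<close>-balancedness, where \<open>A\<close> acts on \<open>B\<close> from both sides through \<open>\<phi>\<close>. No
  relation for \<open>K\<close> is needed: the action of \<open>k\<close> on \<open>B\<close> is multiplication by the central element
  \<open>\<phi> (k \<odot> \<one>)\<close>.
\<close>

type_synonym 'b tensor = "('b \<times> 'b \<Rightarrow>\<^sub>0 int) set"

abbreviation tensor_free ::
    "('b, 'n) ring_scheme \<Rightarrow> ('b \<times> 'b \<Rightarrow>\<^sub>0 int) monoid" where
  "tensor_free B \<equiv> free_Abelian_group (carrier B \<times> carrier B)"

definition tensor_relators ::
    "('a, 'm) ring_scheme \<Rightarrow> ('b, 'n) ring_scheme \<Rightarrow> ('a \<Rightarrow> 'b) \<Rightarrow> ('b \<times> 'b \<Rightarrow>\<^sub>0 int) set" where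
  "tensor_relators A B \<phi> =
    {frag_of (x \<oplus>\<^bsub>B\<^esub> x', y) - frag_of (x, y) - frag_of (x', y) | x x' y.
       x \<in> carrier B \<and> x' \<in> carrier B \<and> y \<in> carrier B} \<union>
    {frag_of (x, y \<oplus>\<^bsub>B\<^esub> y') - frag_of (x, y) - frag_of (x, y') | x y y'.
       x \<in> carrier B \<and> y \<in> carrier B \<and> y' \<in> carrier B} \<union>
    {frag_of (x \<otimes>\<^bsub>B\<^esub> \<phi> a, y) - frag_of (x, \<phi> a \<otimes>\<^bsub>B\<^esub> y) | x a y.
       x \<in> carrier B \<and> a \<in> carrier A \<and> y \<in> carrier B}"

definition tensor_null ::
    "('a, 'm) ring_scheme \<Rightarrow> ('b, 'n) ring_scheme \<Rightarrow> ('a \<Rightarrow> 'b) \<Rightarrow> 'b tensor" where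
  "tensor_null A B \<phi> = generate (tensor_free B) (tensor_relators A B \<phi>)"

definition tensor_group ::
    "('a, 'm) ring_scheme \<Rightarrow> ('b, 'n) ring_scheme \<Rightarrow> ('a \<Rightarrow> 'b) \<Rightarrow> 'b tensor monoid" where
  "tensor_group A B \<phi> = tensor_free B Mod tensor_null A B \<phi>"

definition pure_tensor ::
    "('a, 'm) ring_scheme \<Rightarrow> ('b, 'n) ring_scheme \<Rightarrow> ('a \<Rightarrow> 'b) \<Rightarrow> 'b \<Rightarrow> 'b \<Rightarrow> 'b tensor" where
  "pure_tensor A B \<phi> x y = tensor_null A B \<phi> #>\<^bsub>tensor_free B\<^esub> frag_of (x, y)"

text \<open>
  The additive map on the quotient induced by an assignment \<open>f\<close> of formal sums to the generators.
  The union collapses to a single coset whenever \<open>f\<close> respects the relators.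
\<close>

definition tensor_lift ::
    "('a, 'm) ring_scheme \<Rightarrow> ('b, 'n) ring_scheme \<Rightarrow> ('a \<Rightarrow> 'b) \<Rightarrow>
     ('b \<times> 'b \<Rightarrow> ('b \<times> 'b \<Rightarrow>\<^sub>0 int)) \<Rightarrow> 'b tensor \<Rightarrow> 'b tensor" where
  "tensor_lift A B \<phi> f t = (\<Union>c\<in>t. tensor_null A B \<phi> #>\<^bsub>tensor_free B\<^esub> frag_extend f c)"

text \<open>
  The grading involution \<open>x \<mapsto> (-1)\<^bsup>|x|\<^esup> x\<close>, extended additively to inhomogeneous elements. It
  turns the Koszul rule into a formula \<open>d (x \<otimes> y) = d x \<otimes> y + \<epsilon> x \<otimes> d y\<close> for all \<open>x\<close> and \<open>y\<close>.
\<close>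

definition grading_involution :: "('k, 'a, 'm) dg_module_scheme \<Rightarrow> 'a \<Rightarrow> 'a" where
  "grading_involution M a =
    (let f = (THE f. homogeneous_decomposition M a f)
     in (\<Oplus>\<^bsub>M\<^esub>n\<in>{n. f n \<noteq> \<zero>\<^bsub>M\<^esub>}. koszul_sign M n (f n)))"

definition tensor_dg_bimodule ::
    "('a, 'm) ring_scheme \<Rightarrow> ('k, 'b, 'n) dg_module_scheme \<Rightarrow> ('a \<Rightarrow> 'b) \<Rightarrow>
     ('k, 'b, 'b tensor) dg_bimodule" where
  "tensor_dg_bimodule A B \<phi> =
    \<lparr>carrier = carrier (tensor_group A B \<phi>),
     monoid.mult = undefined, one = undefined,
     ring.zero = \<one>\<^bsub>tensor_group A B \<phi>\<^esub>, ring.add = monoid.mult (tensor_group A B \<phi>),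
     smult = (\<lambda>k. tensor_lift A B \<phi> (\<lambda>(x, y). frag_of (k \<odot>\<^bsub>B\<^esub> x, y))),
     grade = (\<lambda>n. generate (tensor_group A B \<phi>)
       {pure_tensor A B \<phi> x y | x y i j. x \<in> grade B i \<and> y \<in> grade B j \<and> i + j = n}),
     diff = tensor_lift A B \<phi>
       (\<lambda>(x, y). frag_of (diff B x, y) + frag_of (grading_involution B x, diff B y)),
     lact = (\<lambda>b. tensor_lift A B \<phi> (\<lambda>(x, y). frag_of (b \<otimes>\<^bsub>B\<^esub> x, y))),
     ract = (\<lambda>t b. tensor_lift A B \<phi> (\<lambda>(x, y). frag_of (x, y \<otimes>\<^bsub>B\<^esub> b)) t)\<rparr>"

text \<open>A coset is sent to the common value of \<open>\<Sum>\<^sub>i n\<^sub>i (x\<^sub>i, y\<^sub>i) \<mapsto> \<Sum>\<^sub>i n\<^sub>i x\<^sub>i y\<^sub>i\<close> on its elements.\<close>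

definition tensor_mult :: "('b, 'n) ring_scheme \<Rightarrow> 'b tensor \<Rightarrow> 'b" where
  "tensor_mult B t = the_elem
    ((\<lambda>c. \<Oplus>\<^bsub>B\<^esub>p\<in>Poly_Mapping.keys c.
        [Poly_Mapping.lookup c p] \<cdot>\<^bsub>B\<^esub> (fst p \<otimes>\<^bsub>B\<^esub> snd p)) ` t)"

definition dg_separable ::
    "('k, 'r) ring_scheme \<Rightarrow> ('a, 'm) ring_scheme \<Rightarrow> ('k, 'b, 'n) dg_module_scheme \<Rightarrow>
     ('a \<Rightarrow> 'b) \<Rightarrow> bool" where
  "dg_separable K A B \<phi> \<longleftrightarrow>
    (\<exists>\<rho> \<in> dg_bimodule_hom K B (regular_dg_bimodule B) (tensor_dg_bimodule A B \<phi>).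
       \<forall>b\<in>carrier B. tensor_mult B (\<rho> b) = b)"

section \<open>The operations on the tensor product are well defined\<close>

text \<open>
  Each \<open>tensor_lift\<close> above, as well as \<open>tensor_mult\<close>, respects the relators; hence the expected formulas
  on pure tensors, in particular the Koszul rule \<open>diff_pure_tensor\<close>.
\<close>

context dg_extension
begin

abbreviation (input) "Free \<equiv> tensor_free B"
abbreviation (input) "Rel \<equiv> tensor_relators A B \<phi>"
abbreviation (input) "Null \<equiv> tensor_null A B \<phi>"

lemma hom_closed [simp]: "a \<in> carrier A \<Longrightarrow> \<phi> a \<in> carrier B"
  using hom by (rule ring_hom_closed)

lemma keys_relators: "r \<in> Rel \<Longrightarrow> Poly_Mapping.keys r \<subseteq> carrier B \<times> carrier B"
proof -
  have k: "Poly_Mapping.keys (frag_of p - frag_of q) \<subseteq> {p, q}" for p q :: "'b \<times> 'b"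
    using keys_diff[of "frag_of p" "frag_of q"] by (auto split: if_splits)
  have k3: "Poly_Mapping.keys (frag_of p - frag_of q - frag_of s) \<subseteq> {p, q, s}" for p q s :: "'b \<times> 'b"
    using keys_diff[of "frag_of p - frag_of q" "frag_of s"] k[of p q] by (auto split: if_splits)
  assume "r \<in> Rel"
  then show ?thesis
    unfolding tensor_relators_def
    by (elim UnE CollectE exE conjE; hypsubst; intro subset_trans[OF k3] subset_trans[OF k]) auto
qed

lemma tensor_null_subgroup: "subgroup Null Free"
  unfolding tensor_null_def
  by (rule group.generate_is_subgroup) (use keys_relators in auto)

lemma tensor_null_normal: "Null \<lhd> Free"
  by (intro comm_group.subgroup_imp_normal abelian_free_Abelian_group tensor_null_subgroup)

lemma in_coset_iff:
  assumes "Poly_Mapping.keys c \<subseteq> carrier B \<times> carrier B"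
  shows "e \<in> Null #>\<^bsub>Free\<^esub> c \<longleftrightarrow> (\<exists>n\<in>Null. e = n + c)"
  by (auto simp: r_coset_def)

lemma tensor_null_carrier: "n \<in> Null \<Longrightarrow> Poly_Mapping.keys n \<subseteq> carrier B \<times> carrier B"
  using subgroup.mem_carrier[OF tensor_null_subgroup, of n] by simp

lemma coset_absorb:
  assumes "n \<in> Null" "Poly_Mapping.keys c \<subseteq> carrier B \<times> carrier B"
  shows "Null #>\<^bsub>Free\<^esub> (n + c) = Null #>\<^bsub>Free\<^esub> c"
proof -
  have "n + c \<in> Null #>\<^bsub>Free\<^esub> c" using assms by (auto simp: r_coset_def)
  then show ?thesis
    using group.repr_independence[OF group_free_Abelian_group _ _ tensor_null_subgroup] assms by fastforce
qed

lemma frag_extend_null: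
  assumes f: "\<And>p. p \<in> carrier B \<times> carrier B \<Longrightarrow> Poly_Mapping.keys (f p) \<subseteq> carrier B \<times> carrier B"
    and r: "\<And>r. r \<in> Rel \<Longrightarrow> frag_extend f r \<in> Null"
    and n: "n \<in> Null"
  shows "frag_extend f n \<in> Null"
  using n[unfolded tensor_null_def]
proof (induction rule: generate.induct)
  case one
  show ?case using subgroup.one_closed[OF tensor_null_subgroup] by simp
next
  case (incl h)
  show ?case by (rule r[OF incl])
next
  case (inv h)
  have h: "frag_extend f h \<in> Null" by (rule r[OF inv])
  have "frag_extend f (inv\<^bsub>Free\<^esub> h) = inv\<^bsub>Free\<^esub> (frag_extend f h)"
    unfolding inv_free_Abelian_group[OF keys_relators[OF inv]]
      inv_free_Abelian_group[OF tensor_null_carrier[OF h]]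
    by (rule frag_extend_minus)
  then show ?case
    using subgroup.m_inv_closed[OF tensor_null_subgroup h] by metis
next
  case (eng h1 h2)
  have "frag_extend f h1 \<otimes>\<^bsub>Free\<^esub> frag_extend f h2 \<in> Null"
    by (rule subgroup.m_closed[OF tensor_null_subgroup eng.IH])
  then show ?case by (simp only: mult_free_Abelian_group frag_extend_add)
qed

lemma tensor_lift_coset:
  assumes f: "\<And>p. p \<in> carrier B \<times> carrier B \<Longrightarrow> Poly_Mapping.keys (f p) \<subseteq> carrier B \<times> carrier B"
    and r: "\<And>r. r \<in> Rel \<Longrightarrow> frag_extend f r \<in> Null"
    and c: "Poly_Mapping.keys c \<subseteq> carrier B \<times> carrier B"
  shows "tensor_lift A B \<phi> f (Null #>\<^bsub>Free\<^esub> c) = Null #>\<^bsub>Free\<^esub> frag_extend f c"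
proof -
  have e: "Poly_Mapping.keys (frag_extend f c) \<subseteq> carrier B \<times> carrier B"
  proof (rule subset_trans[OF keys_frag_extend], rule UN_least)
    show "Poly_Mapping.keys (f p) \<subseteq> carrier B \<times> carrier B" if "p \<in> Poly_Mapping.keys c" for p
      by (rule f[OF subsetD[OF c that]])
  qed
  have 1: "Null #>\<^bsub>Free\<^esub> frag_extend f c' = Null #>\<^bsub>Free\<^esub> frag_extend f c" if c': "c' \<in> Null #>\<^bsub>Free\<^esub> c" for c'
  proof -
    obtain n where "n \<in> Null" "c' = n + c" using c' unfolding in_coset_iff[OF c] by blast
    then show ?thesis
      using coset_absorb[OF frag_extend_null[OF f r \<open>n \<in> Null\<close>] e] by (simp only: frag_extend_add)
  qed
  have "0 \<in> Null" using subgroup.one_closed[OF tensor_null_subgroup] by simp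
  then have "c \<in> Null #>\<^bsub>Free\<^esub> c" unfolding in_coset_iff[OF c] by (intro bexI[of _ 0]) simp
  have "(\<lambda>c'. Null #>\<^bsub>Free\<^esub> frag_extend f c') ` (Null #>\<^bsub>Free\<^esub> c) = {Null #>\<^bsub>Free\<^esub> frag_extend f c}"
    using image_constant[OF \<open>c \<in> Null #>\<^bsub>Free\<^esub> c\<close>, of "Null #>\<^bsub>Free\<^esub> frag_extend f c"] image_cong[OF refl 1]
    by (rule trans[rotated])
  then show ?thesis unfolding tensor_lift_def by (simp only: cSup_singleton)
qed

lemma keys_sumI:
  "\<lbrakk>Poly_Mapping.keys a \<subseteq> S; Poly_Mapping.keys b \<subseteq> S\<rbrakk> \<Longrightarrow> Poly_Mapping.keys (a + b) \<subseteq> S"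
  using keys_add[of a b] by blast

lemma null_add: "\<lbrakk>a \<in> Null; b \<in> Null\<rbrakk> \<Longrightarrow> a + b \<in> Null"
  using subgroup.m_closed[OF tensor_null_subgroup] by simp

lemma null_minus: "\<lbrakk>a \<in> Null\<rbrakk> \<Longrightarrow> - a \<in> Null"
  using subgroup.m_inv_closed[OF tensor_null_subgroup] inv_free_Abelian_group[OF tensor_null_carrier]
  by metis

lemma null_diff: "\<lbrakk>a \<in> Null; b \<in> Null\<rbrakk> \<Longrightarrow> a - b \<in> Null"
  unfolding diff_conv_add_uminus by (intro null_add null_minus)

lemma null_l: "\<lbrakk>x \<in> carrier B; x' \<in> carrier B; y \<in> carrier B\<rbrakk> \<Longrightarrow>
    frag_of (x \<oplus>\<^bsub>B\<^esub> x', y) - frag_of (x, y) - frag_of (x', y) \<in> Null"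
  unfolding tensor_null_def by (rule generate.incl) (auto simp: tensor_relators_def)

lemma null_r: "\<lbrakk>x \<in> carrier B; y \<in> carrier B; y' \<in> carrier B\<rbrakk> \<Longrightarrow>
    frag_of (x, y \<oplus>\<^bsub>B\<^esub> y') - frag_of (x, y) - frag_of (x, y') \<in> Null"
  unfolding tensor_null_def by (rule generate.incl) (auto simp: tensor_relators_def)

lemma null_bal: "\<lbrakk>x \<in> carrier B; a \<in> carrier A; y \<in> carrier B\<rbrakk> \<Longrightarrow>
    frag_of (x \<otimes>\<^bsub>B\<^esub> \<phi> a, y) - frag_of (x, \<phi> a \<otimes>\<^bsub>B\<^esub> y) \<in> Null"
  unfolding tensor_null_def by (rule generate.incl) (auto simp: tensor_relators_def)

lemma lift_relators:
  assumes "\<And>x x' y. \<lbrakk>x \<in> carrier B; x' \<in> carrier B; y \<in> carrier B\<rbrakk> \<Longrightarrow>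
      f (x \<oplus>\<^bsub>B\<^esub> x', y) - f (x, y) - f (x', y) \<in> Null"
    and "\<And>x y y'. \<lbrakk>x \<in> carrier B; y \<in> carrier B; y' \<in> carrier B\<rbrakk> \<Longrightarrow>
      f (x, y \<oplus>\<^bsub>B\<^esub> y') - f (x, y) - f (x, y') \<in> Null"
    and "\<And>x a y. \<lbrakk>x \<in> carrier B; a \<in> carrier A; y \<in> carrier B\<rbrakk> \<Longrightarrow>
      f (x \<otimes>\<^bsub>B\<^esub> \<phi> a, y) - f (x, \<phi> a \<otimes>\<^bsub>B\<^esub> y) \<in> Null"
    and "r \<in> Rel"
  shows "frag_extend f r \<in> Null"
  using assms(4) unfolding tensor_relators_def
  by (elim UnE CollectE exE conjE; hypsubst) (simp_all add: frag_extend_diff assms(1-3))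

lemma lact_coset:
  assumes "b \<in> carrier B" "Poly_Mapping.keys c \<subseteq> carrier B \<times> carrier B"
  shows "lact (tensor_dg_bimodule A B \<phi>) b (Null #>\<^bsub>Free\<^esub> c) =
    Null #>\<^bsub>Free\<^esub> frag_extend (\<lambda>(x, y). frag_of (b \<otimes>\<^bsub>B\<^esub> x, y)) c"
  unfolding tensor_dg_bimodule_def dg_bimodule.simps
  by (rule tensor_lift_coset[OF _ lift_relators])
    (use assms in \<open>auto simp: B.r_distr null_l null_r null_bal B.m_assoc[symmetric] split: if_splits\<close>)

lemma ract_coset:
  assumes "b \<in> carrier B" "Poly_Mapping.keys c \<subseteq> carrier B \<times> carrier B"
  shows "ract (tensor_dg_bimodule A B \<phi>) (Null #>\<^bsub>Free\<^esub> c) b =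
    Null #>\<^bsub>Free\<^esub> frag_extend (\<lambda>(x, y). frag_of (x, y \<otimes>\<^bsub>B\<^esub> b)) c"
  unfolding tensor_dg_bimodule_def dg_bimodule.simps
  by (rule tensor_lift_coset[OF _ lift_relators])
    (use assms in \<open>auto simp: B.l_distr null_l null_r null_bal B.m_assoc split: if_splits\<close>)

lemma smult_coset:
  assumes "k \<in> carrier K" "Poly_Mapping.keys c \<subseteq> carrier B \<times> carrier B"
  shows "k \<odot>\<^bsub>tensor_dg_bimodule A B \<phi>\<^esub> (Null #>\<^bsub>Free\<^esub> c) =
    Null #>\<^bsub>Free\<^esub> frag_extend (\<lambda>(x, y). frag_of (k \<odot>\<^bsub>B\<^esub> x, y)) c"
  unfolding tensor_dg_bimodule_def module.simps
  by (rule tensor_lift_coset[OF _ lift_relators])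
    (use assms in \<open>auto simp: B.smult_r_distr null_l null_r null_bal B.smult_mult_left[symmetric] split: if_splits\<close>)

end

context dg_algebra begin

lemma grade_carrier: "a \<in> grade A n \<Longrightarrow> a \<in> carrier A"
  using submoduleE(1)[OF grade_submodule] by blast

abbreviation "hcomp a \<equiv> (THE f. homogeneous_decomposition A a f)"

lemma hcomp_decomposition: "a \<in> carrier A \<Longrightarrow> homogeneous_decomposition A a (hcomp a)"
  using theI'[OF grade_direct_sum] .

lemma hcomp_eqI: "homogeneous_decomposition A a f \<Longrightarrow> hcomp a = f"
proof -
  assume h: "homogeneous_decomposition A a f"
  then have "a \<in> carrier A"
    unfolding homogeneous_decomposition_def using grade_carrier by (auto intro!: finsum_closed)
  then show ?thesis using h grade_direct_sum the1_equality by metis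
qed

lemma zero_grade: "\<zero>\<^bsub>A\<^esub> \<in> grade A n"
  using subgroup.one_closed[OF submodule.axioms(1)[OF grade_submodule[of n]]] by simp

lemma dehcomp_eqI:
  assumes f: "\<And>n. f n \<in> grade A n" and S: "finite S" "\<And>n. n \<notin> S \<Longrightarrow> f n = \<zero>\<^bsub>A\<^esub>"
  shows "homogeneous_decomposition A (\<Oplus>\<^bsub>A\<^esub>n\<in>S. f n) f"
proof -
  have "{n. f n \<noteq> \<zero>\<^bsub>A\<^esub>} \<subseteq> S" using S by auto
  then have "(\<Oplus>\<^bsub>A\<^esub>n\<in>{n. f n \<noteq> \<zero>\<^bsub>A\<^esub>}. f n) = (\<Oplus>\<^bsub>A\<^esub>n\<in>S. f n)"
    using f[THEN grade_carrier] by (intro add.finprod_mono_neutral_cong_left S(1)) auto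
  then show ?thesis unfolding homogeneous_decomposition_def
    using f finite_subset[OF \<open>_ \<subseteq> S\<close> S(1)] by auto
qed

lemma sign_zero [simp]: "koszul_sign A n \<zero>\<^bsub>A\<^esub> = \<zero>\<^bsub>A\<^esub>" by (simp add: koszul_sign_def)

lemma sign_closed [simp]: "a \<in> carrier A \<Longrightarrow> koszul_sign A n a \<in> carrier A" by (simp add: koszul_sign_def)

lemma sign_add: "a \<in> carrier A \<Longrightarrow> b \<in> carrier A \<Longrightarrow>
   koszul_sign A n (a \<oplus>\<^bsub>A\<^esub> b) = koszul_sign A n a \<oplus>\<^bsub>A\<^esub> koszul_sign A n b"
  by (simp add: koszul_sign_def minus_add a_comm)

lemma invol_eq:
  assumes f: "\<And>n. f n \<in> grade A n" and S: "finite S" "\<And>n. n \<notin> S \<Longrightarrow> f n = \<zero>\<^bsub>A\<^esub>"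
  shows "grading_involution A (\<Oplus>\<^bsub>A\<^esub>n\<in>S. f n) = (\<Oplus>\<^bsub>A\<^esub>n\<in>S. koszul_sign A n (f n))"
proof -
  have "{n. f n \<noteq> \<zero>\<^bsub>A\<^esub>} \<subseteq> S" using S by auto
  then show ?thesis
    using f[THEN grade_carrier] hcomp_eqI[OF dehcomp_eqI[OF assms]]
    unfolding grading_involution_def Let_def
    by (simp only:) (intro add.finprod_mono_neutral_cong_left S(1), auto)
qed

lemma invol_homog: "a \<in> grade A n \<Longrightarrow> grading_involution A a = koszul_sign A n a"
  using invol_eq[of "\<lambda>i. if i = n then a else \<zero>\<^bsub>A\<^esub>" "{n}"] zero_grade grade_carrier[of a n]
  by auto

lemma obtain_decomp:
  assumes "a \<in> carrier A"
  obtains f S where "\<And>n. f n \<in> grade A n" "finite S" "\<And>n. n \<notin> S \<Longrightarrow> f n = \<zero>\<^bsub>A\<^esub>"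
    "a = (\<Oplus>\<^bsub>A\<^esub>n\<in>S. f n)"
  using hcomp_decomposition[OF assms] unfolding homogeneous_decomposition_def by blast

lemma invol_closed: "a \<in> carrier A \<Longrightarrow> grading_involution A a \<in> carrier A"
proof (erule obtain_decomp)
  fix f S assume f: "\<And>n. f n \<in> grade A n" and "finite S" "\<And>n. n \<notin> S \<Longrightarrow> f n = \<zero>\<^bsub>A\<^esub>" "a = (\<Oplus>\<^bsub>A\<^esub>n\<in>S. f n)"
  then show ?thesis using f[THEN grade_carrier] by (auto simp: invol_eq[OF f] intro!: finsum_closed)
qed

lemma invol_add:
  assumes "a \<in> carrier A" "b \<in> carrier A"
  shows "grading_involution A (a \<oplus>\<^bsub>A\<^esub> b) = grading_involution A a \<oplus>\<^bsub>A\<^esub> grading_involution A b"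
proof -
  obtain f S where f: "\<And>n. f n \<in> grade A n" "finite S" "\<And>n. n \<notin> S \<Longrightarrow> f n = \<zero>\<^bsub>A\<^esub>"
    "a = (\<Oplus>\<^bsub>A\<^esub>n\<in>S. f n)" using obtain_decomp[OF assms(1)] by blast
  obtain g T where g: "\<And>n. g n \<in> grade A n" "finite T" "\<And>n. n \<notin> T \<Longrightarrow> g n = \<zero>\<^bsub>A\<^esub>"
    "b = (\<Oplus>\<^bsub>A\<^esub>n\<in>T. g n)" using obtain_decomp[OF assms(2)] by blast
  have fc: "f \<in> U \<rightarrow> carrier A" "g \<in> U \<rightarrow> carrier A" for U using f(1)[THEN grade_carrier] g(1)[THEN grade_carrier] by auto
  have a: "a = (\<Oplus>\<^bsub>A\<^esub>n\<in>S\<union>T. f n)" unfolding f(4) using f g fc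
    by (intro add.finprod_mono_neutral_cong_left) auto
  have b: "b = (\<Oplus>\<^bsub>A\<^esub>n\<in>S\<union>T. g n)" unfolding g(4) using f g fc
    by (intro add.finprod_mono_neutral_cong_left) auto
  have ab: "a \<oplus>\<^bsub>A\<^esub> b = (\<Oplus>\<^bsub>A\<^esub>n\<in>S\<union>T. f n \<oplus>\<^bsub>A\<^esub> g n)"
    unfolding a b by (rule finsum_addf[symmetric]) (use fc in auto)
  have fg: "f n \<oplus>\<^bsub>A\<^esub> g n \<in> grade A n" for n
    by (rule submoduleE(5)[OF grade_submodule f(1) g(1)])
  have "grading_involution A (a \<oplus>\<^bsub>A\<^esub> b) = (\<Oplus>\<^bsub>A\<^esub>n\<in>S\<union>T. koszul_sign A n (f n \<oplus>\<^bsub>A\<^esub> g n))"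
    unfolding ab by (rule invol_eq) (use fg f g in auto)
  also have "\<dots> = (\<Oplus>\<^bsub>A\<^esub>n\<in>S\<union>T. koszul_sign A n (f n) \<oplus>\<^bsub>A\<^esub> koszul_sign A n (g n))"
    using f(1)[THEN grade_carrier] g(1)[THEN grade_carrier] by (intro finsum_cong') (auto simp: sign_add)
  also have "\<dots> = (\<Oplus>\<^bsub>A\<^esub>n\<in>S\<union>T. koszul_sign A n (f n)) \<oplus>\<^bsub>A\<^esub> (\<Oplus>\<^bsub>A\<^esub>n\<in>S\<union>T. koszul_sign A n (g n))"
    by (rule finsum_addf) (use f(1)[THEN grade_carrier] g(1)[THEN grade_carrier] in auto)
  also have "(\<Oplus>\<^bsub>A\<^esub>n\<in>S\<union>T. koszul_sign A n (f n)) = grading_involution A a"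
    unfolding a by (rule invol_eq[symmetric]) (use f g in auto)
  also have "(\<Oplus>\<^bsub>A\<^esub>n\<in>S\<union>T. koszul_sign A n (g n)) = grading_involution A b"
    unfolding b by (rule invol_eq[symmetric]) (use f g in auto)
  finally show ?thesis .
qed

lemma homog_induct [consumes 1, case_names homog zero add]:
  assumes "a \<in> carrier A" and h: "\<And>n a. a \<in> grade A n \<Longrightarrow> P a"
    and z: "P \<zero>\<^bsub>A\<^esub>"
    and add: "\<And>a b. \<lbrakk>a \<in> carrier A; b \<in> carrier A; P a; P b\<rbrakk> \<Longrightarrow> P (a \<oplus>\<^bsub>A\<^esub> b)"
  shows "P a"
proof -
  obtain f S where f: "\<And>n. f n \<in> grade A n" "finite S" "a = (\<Oplus>\<^bsub>A\<^esub>n\<in>S. f n)"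
    using obtain_decomp[OF assms(1)] by metis
  have fc: "f n \<in> carrier A" for n using f(1) grade_carrier by blast
  have "P (\<Oplus>\<^bsub>A\<^esub>n\<in>S. f n)" using \<open>finite S\<close>
    by (induction S rule: finite_induct) (auto intro!: z add h[OF f(1)] simp: fc Pi_I)
  then show ?thesis using f by simp
qed

lemma invol_zero: "grading_involution A \<zero>\<^bsub>A\<^esub> = \<zero>\<^bsub>A\<^esub>"
  using invol_homog[OF zero_grade[of 0]] by simp

lemma diff_zero: "diff A \<zero>\<^bsub>A\<^esub> = \<zero>\<^bsub>A\<^esub>"
  using diff_add[of "\<zero>\<^bsub>A\<^esub>" "\<zero>\<^bsub>A\<^esub>"] diff_closed[of "\<zero>\<^bsub>A\<^esub>"]
  by (metis add.l_cancel_one' zero_closed l_zero)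

lemma invol_mult:
  assumes "a \<in> carrier A" "b \<in> carrier A"
  shows "grading_involution A (a \<otimes>\<^bsub>A\<^esub> b) = grading_involution A a \<otimes>\<^bsub>A\<^esub> grading_involution A b"
  using assms(1)
proof (induction rule: homog_induct)
  case (homog m a)
  show ?case using assms(2)
  proof (induction rule: homog_induct)
    case (homog n b)
    then show ?case using \<open>a \<in> _\<close> grade_carrier[of a m] grade_carrier[of b n]
      by (simp add: invol_homog[OF grade_mult] invol_homog koszul_sign_def l_minus r_minus)
  qed (use homog grade_carrier[of a m] in \<open>auto simp: invol_zero invol_add r_distr invol_closed\<close>)
qed (use assms in \<open>auto simp: invol_zero invol_add l_distr invol_closed\<close>)

lemma leibniz':
  assumes "a \<in> carrier A" "b \<in> carrier A"
  shows "diff A (a \<otimes>\<^bsub>A\<^esub> b) = diff A a \<otimes>\<^bsub>A\<^esub> b \<oplus>\<^bsub>A\<^esub> grading_involution A a \<otimes>\<^bsub>A\<^esub> diff A b"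
  using assms(1)
proof (induction rule: homog_induct)
  case (homog m a)
  show ?case using assms(2)
  proof (induction rule: homog_induct)
    case (homog n b)
    then show ?case using \<open>a \<in> _\<close> grade_carrier[of a m] grade_carrier[of b n]
      by (simp add: leibniz invol_homog koszul_sign_def l_minus r_minus diff_closed)
  qed (use homog grade_carrier[of a m] in \<open>auto simp: diff_zero diff_closed diff_add r_distr invol_closed a_ac\<close>)
qed (use assms in \<open>auto simp: diff_zero diff_closed diff_add invol_zero invol_add l_distr invol_closed a_ac\<close>)

end

context dg_extension begin

lemma hom_zero: "\<phi> \<zero>\<^bsub>A\<^esub> = \<zero>\<^bsub>B\<^esub>"
  using ring_hom_zero[OF hom A.A.ring_axioms B.A.ring_axioms] .

lemma hom_add: "a \<in> carrier A \<Longrightarrow> b \<in> carrier A \<Longrightarrow> \<phi> (a \<oplus>\<^bsub>A\<^esub> b) = \<phi> a \<oplus>\<^bsub>B\<^esub> \<phi> b"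
  using ring_hom_add[OF hom] .

lemma hom_minus: "a \<in> carrier A \<Longrightarrow> \<phi> (\<ominus>\<^bsub>A\<^esub> a) = \<ominus>\<^bsub>B\<^esub> \<phi> a"
  using hom_add[of a "\<ominus>\<^bsub>A\<^esub> a"] hom_zero
  by (metis A.a_inv_closed A.r_neg B.minus_equality B.a_comm hom_closed)

lemma hom_invol: "a \<in> carrier A \<Longrightarrow> grading_involution B (\<phi> a) = \<phi> (grading_involution A a)"
proof (induction rule: A.homog_induct)
  case (homog n a)
  then show ?case using A.grade_carrier[OF homog]
    by (simp add: A.invol_homog B.invol_homog[OF hom_grade] koszul_sign_def hom_minus)
qed (auto simp: hom_zero A.invol_zero B.invol_zero hom_add A.invol_add B.invol_add A.invol_closed)

lemma diff_coset:
  assumes "Poly_Mapping.keys c \<subseteq> carrier B \<times> carrier B"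
  shows "diff (tensor_dg_bimodule A B \<phi>) (Null #>\<^bsub>Free\<^esub> c) =
    Null #>\<^bsub>Free\<^esub> frag_extend (\<lambda>(x, y). frag_of (diff B x, y) + frag_of (grading_involution B x, diff B y)) c"
  unfolding tensor_dg_bimodule_def dg_module.simps
proof (rule tensor_lift_coset[OF _ lift_relators assms], goal_cases)
  case (1 p)
  then show ?case
    by (cases p, simp only: prod.case) (rule keys_sumI; simp add: B.diff_closed B.invol_closed)
next
  case (2 r x x' y)
  have "frag_of (diff B x \<oplus>\<^bsub>B\<^esub> diff B x', y) - frag_of (diff B x, y) - frag_of (diff B x', y) \<in> Null"
   "frag_of (grading_involution B x \<oplus>\<^bsub>B\<^esub> grading_involution B x', diff B y) - frag_of (grading_involution B x, diff B y) - frag_of (grading_involution B x', diff B y) \<in> Null"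
    using 2 by (auto intro!: null_l simp: B.diff_closed B.invol_closed)
  from null_add[OF this] show ?case using 2 by (simp add: B.diff_add B.invol_add algebra_simps)
next
  case (3 r x y y')
  have "frag_of (diff B x, y \<oplus>\<^bsub>B\<^esub> y') - frag_of (diff B x, y) - frag_of (diff B x, y') \<in> Null"
   "frag_of (grading_involution B x, diff B y \<oplus>\<^bsub>B\<^esub> diff B y') - frag_of (grading_involution B x, diff B y) - frag_of (grading_involution B x, diff B y') \<in> Null"
    using 3 by (auto intro!: null_r simp: B.diff_closed B.invol_closed)
  from null_add[OF this] show ?case using 3 by (simp add: B.diff_add algebra_simps)
next
  case (4 r x a y)
  let ?e = "grading_involution B" and ?d = "diff B"
  note c = 4(2-4) B.diff_closed B.invol_closed A.diff_closed A.invol_closed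
  have 1: "frag_of (?d x \<otimes>\<^bsub>B\<^esub> \<phi> a, y) - frag_of (?d x, \<phi> a \<otimes>\<^bsub>B\<^esub> y) \<in> Null"
    using c by (intro null_bal) auto
  have 2: "frag_of (?e x \<otimes>\<^bsub>B\<^esub> \<phi> (diff A a), y) - frag_of (?e x, \<phi> (diff A a) \<otimes>\<^bsub>B\<^esub> y) \<in> Null"
    using c by (intro null_bal) auto
  have 3: "frag_of (?e x \<otimes>\<^bsub>B\<^esub> \<phi> (grading_involution A a), ?d y) - frag_of (?e x, \<phi> (grading_involution A a) \<otimes>\<^bsub>B\<^esub> ?d y) \<in> Null"
    using c by (intro null_bal) auto
  have l: "frag_of (?d x \<otimes>\<^bsub>B\<^esub> \<phi> a \<oplus>\<^bsub>B\<^esub> ?e x \<otimes>\<^bsub>B\<^esub> \<phi> (diff A a), y) - frag_of (?d x \<otimes>\<^bsub>B\<^esub> \<phi> a, y) - frag_of (?e x \<otimes>\<^bsub>B\<^esub> \<phi> (diff A a), y) \<in> Null"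
    using c by (intro null_l) auto
  have r: "frag_of (?e x, \<phi> (diff A a) \<otimes>\<^bsub>B\<^esub> y \<oplus>\<^bsub>B\<^esub> \<phi> (grading_involution A a) \<otimes>\<^bsub>B\<^esub> ?d y) - frag_of (?e x, \<phi> (diff A a) \<otimes>\<^bsub>B\<^esub> y) - frag_of (?e x, \<phi> (grading_involution A a) \<otimes>\<^bsub>B\<^esub> ?d y) \<in> Null"
    using c by (intro null_r) auto
  have e: "?d (x \<otimes>\<^bsub>B\<^esub> \<phi> a) = ?d x \<otimes>\<^bsub>B\<^esub> \<phi> a \<oplus>\<^bsub>B\<^esub> ?e x \<otimes>\<^bsub>B\<^esub> \<phi> (diff A a)"
     "?d (\<phi> a \<otimes>\<^bsub>B\<^esub> y) = \<phi> (diff A a) \<otimes>\<^bsub>B\<^esub> y \<oplus>\<^bsub>B\<^esub> \<phi> (grading_involution A a) \<otimes>\<^bsub>B\<^esub> ?d y"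
     "?e (x \<otimes>\<^bsub>B\<^esub> \<phi> a) = ?e x \<otimes>\<^bsub>B\<^esub> \<phi> (grading_involution A a)"
    using c by (simp_all add: B.leibniz' B.invol_mult hom_diff hom_invol)
  show ?case unfolding prod.case e
    using null_add[OF null_add[OF null_add[OF 1 2] 3] null_diff[OF l r]] by (simp add: algebra_simps)
qed

lemma lact_pure_tensor:
  "\<lbrakk>b \<in> carrier B; x \<in> carrier B; y \<in> carrier B\<rbrakk> \<Longrightarrow>
    lact (tensor_dg_bimodule A B \<phi>) b (pure_tensor A B \<phi> x y) =
      pure_tensor A B \<phi> (b \<otimes>\<^bsub>B\<^esub> x) y"
  unfolding pure_tensor_def by (simp add: lact_coset)

lemma ract_pure_tensor:
  "\<lbrakk>b \<in> carrier B; x \<in> carrier B; y \<in> carrier B\<rbrakk> \<Longrightarrow>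
    ract (tensor_dg_bimodule A B \<phi>) (pure_tensor A B \<phi> x y) b =
      pure_tensor A B \<phi> x (y \<otimes>\<^bsub>B\<^esub> b)"
  unfolding pure_tensor_def by (simp add: ract_coset)

lemma smult_pure_tensor:
  "\<lbrakk>k \<in> carrier K; x \<in> carrier B; y \<in> carrier B\<rbrakk> \<Longrightarrow>
    k \<odot>\<^bsub>tensor_dg_bimodule A B \<phi>\<^esub> pure_tensor A B \<phi> x y =
      pure_tensor A B \<phi> (k \<odot>\<^bsub>B\<^esub> x) y"
  unfolding pure_tensor_def by (simp add: smult_coset)

lemma pure_tensor_closed: "x \<in> carrier B \<Longrightarrow> y \<in> carrier B \<Longrightarrow> pure_tensor A B \<phi> x y \<in> carrier (tensor_group A B \<phi>)"
  by (auto simp: tensor_group_def carrier_FactGroup pure_tensor_def)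

lemma add_coset: "\<lbrakk>Poly_Mapping.keys c \<subseteq> carrier B \<times> carrier B; Poly_Mapping.keys e \<subseteq> carrier B \<times> carrier B\<rbrakk> \<Longrightarrow>
   (Null #>\<^bsub>Free\<^esub> c) \<oplus>\<^bsub>tensor_dg_bimodule A B \<phi>\<^esub> (Null #>\<^bsub>Free\<^esub> e) = Null #>\<^bsub>Free\<^esub> (c + e)"
  using normal.rcos_sum[OF tensor_null_normal, of c e] by (simp add: tensor_dg_bimodule_def tensor_group_def)

lemma diff_pure_tensor:
  assumes "x \<in> grade B n" "y \<in> carrier B"
  shows "diff (tensor_dg_bimodule A B \<phi>) (pure_tensor A B \<phi> x y) =
    pure_tensor A B \<phi> (diff B x) y \<oplus>\<^bsub>tensor_dg_bimodule A B \<phi>\<^esub> pure_tensor A B \<phi> (koszul_sign B n x) (diff B y)"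
  using assms B.grade_carrier[OF assms(1)] unfolding pure_tensor_def
  by (simp add: diff_coset add_coset B.diff_closed B.invol_homog koszul_sign_def)

abbreviation (input) formal_mult :: "('b \<times> 'b \<Rightarrow>\<^sub>0 int) \<Rightarrow> 'b" where "formal_mult c \<equiv> (\<Oplus>\<^bsub>B\<^esub>p\<in>Poly_Mapping.keys c.
        [Poly_Mapping.lookup c p] \<cdot>\<^bsub>B\<^esub> (fst p \<otimes>\<^bsub>B\<^esub> snd p))"

lemma zpow_0: "[(0::int)] \<cdot>\<^bsub>B\<^esub> x = \<zero>\<^bsub>B\<^esub>"
  by (simp add: add_pow_def)

lemma zpow_1: "x \<in> carrier B \<Longrightarrow> [(1::int)] \<cdot>\<^bsub>B\<^esub> x = x"
  using B.add.int_pow_1[of x] by simp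

lemma zpow_closed: "x \<in> carrier B \<Longrightarrow> [(k::int)] \<cdot>\<^bsub>B\<^esub> x \<in> carrier B"
  using B.add.int_pow_closed[of x k] by simp

lemma zpow_add: "x \<in> carrier B \<Longrightarrow> [(k + l :: int)] \<cdot>\<^bsub>B\<^esub> x = [k] \<cdot>\<^bsub>B\<^esub> x \<oplus>\<^bsub>B\<^esub> [l] \<cdot>\<^bsub>B\<^esub> x"
  using B.add.int_pow_mult[of x k l] by simp

lemma formal_mult_superset:
  assumes "finite S" "Poly_Mapping.keys c \<subseteq> S" "S \<subseteq> carrier B \<times> carrier B"
  shows "formal_mult c = (\<Oplus>\<^bsub>B\<^esub>p\<in>S. [Poly_Mapping.lookup c p] \<cdot>\<^bsub>B\<^esub> (fst p \<otimes>\<^bsub>B\<^esub> snd p))"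
  using assms by (intro B.add.finprod_mono_neutral_cong_left)
     (auto simp: in_keys_iff zpow_0 intro!: zpow_closed)

lemma formal_mult_closed: "Poly_Mapping.keys c \<subseteq> carrier B \<times> carrier B \<Longrightarrow> formal_mult c \<in> carrier B"
  by (intro B.finsum_closed) (auto intro!: zpow_closed)

lemma formal_mult_add:
  assumes c: "Poly_Mapping.keys c \<subseteq> carrier B \<times> carrier B" "Poly_Mapping.keys e \<subseteq> carrier B \<times> carrier B"
  shows "formal_mult (c + e) = formal_mult c \<oplus>\<^bsub>B\<^esub> formal_mult e"
proof -
  let ?S = "Poly_Mapping.keys c \<union> Poly_Mapping.keys e"
  have S: "finite ?S" "?S \<subseteq> carrier B \<times> carrier B" using c by auto
  have "Poly_Mapping.keys (c + e) \<subseteq> ?S" by (rule keys_add)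
  have m: "fst p \<otimes>\<^bsub>B\<^esub> snd p \<in> carrier B" if "p \<in> ?S" for p using that c by auto
  have "formal_mult (c + e) = (\<Oplus>\<^bsub>B\<^esub>p\<in>?S. [Poly_Mapping.lookup c p] \<cdot>\<^bsub>B\<^esub> (fst p \<otimes>\<^bsub>B\<^esub> snd p) \<oplus>\<^bsub>B\<^esub> [Poly_Mapping.lookup e p] \<cdot>\<^bsub>B\<^esub> (fst p \<otimes>\<^bsub>B\<^esub> snd p))"
    unfolding formal_mult_superset[OF S(1) \<open>_ \<subseteq> ?S\<close> S(2)]
    using m by (intro B.finsum_cong') (auto simp: lookup_add zpow_add intro!: zpow_closed)
  also have "\<dots> = (\<Oplus>\<^bsub>B\<^esub>p\<in>?S. [Poly_Mapping.lookup c p] \<cdot>\<^bsub>B\<^esub> (fst p \<otimes>\<^bsub>B\<^esub> snd p)) \<oplus>\<^bsub>B\<^esub> (\<Oplus>\<^bsub>B\<^esub>p\<in>?S. [Poly_Mapping.lookup e p] \<cdot>\<^bsub>B\<^esub> (fst p \<otimes>\<^bsub>B\<^esub> snd p))"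
    by (rule B.finsum_addf) (use m in \<open>auto intro!: zpow_closed\<close>)
  finally show ?thesis
    using formal_mult_superset[OF S(1) Un_upper1 S(2)] formal_mult_superset[OF S(1) Un_upper2 S(2)] by simp
qed

lemma formal_mult_zero: "formal_mult 0 = \<zero>\<^bsub>B\<^esub>" by simp

lemma formal_mult_minus:
  assumes "Poly_Mapping.keys c \<subseteq> carrier B \<times> carrier B"
  shows "formal_mult (- c) = \<ominus>\<^bsub>B\<^esub> formal_mult c"
proof -
  have m: "Poly_Mapping.keys (- c) \<subseteq> carrier B \<times> carrier B" using assms by (simp only: keys_minus)
  have "formal_mult (- c) \<oplus>\<^bsub>B\<^esub> formal_mult c = formal_mult (- c + c)" by (rule formal_mult_add[OF m assms, symmetric])
  also have "\<dots> = \<zero>\<^bsub>B\<^esub>" unfolding left_minus by (rule formal_mult_zero)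
  finally show ?thesis using B.minus_equality[OF _ formal_mult_closed[OF assms] formal_mult_closed[OF m]] by simp
qed

lemma formal_mult_of: "x \<in> carrier B \<Longrightarrow> y \<in> carrier B \<Longrightarrow> formal_mult (frag_of (x, y)) = x \<otimes>\<^bsub>B\<^esub> y"
  by (simp add: zpow_1)

lemma formal_mult_diff:
  assumes c: "Poly_Mapping.keys c \<subseteq> carrier B \<times> carrier B" "Poly_Mapping.keys e \<subseteq> carrier B \<times> carrier B"
  shows "formal_mult (c - e) = formal_mult c \<ominus>\<^bsub>B\<^esub> formal_mult e"
proof -
  have m: "Poly_Mapping.keys (- e) \<subseteq> carrier B \<times> carrier B" using c(2) by (simp only: keys_minus)
  show ?thesis unfolding diff_conv_add_uminus formal_mult_add[OF c(1) m] formal_mult_minus[OF c(2)] a_minus_def ..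
qed

lemma keys_diffI:
  "\<lbrakk>Poly_Mapping.keys a \<subseteq> S; Poly_Mapping.keys b \<subseteq> S\<rbrakk> \<Longrightarrow> Poly_Mapping.keys (a - b) \<subseteq> S"
  for a b :: "'z \<Rightarrow>\<^sub>0 int"
  using keys_diff[of a b] by blast

lemma cancel2: "\<lbrakk>u \<in> carrier B; v \<in> carrier B\<rbrakk> \<Longrightarrow> (u \<oplus>\<^bsub>B\<^esub> v) \<ominus>\<^bsub>B\<^esub> u \<ominus>\<^bsub>B\<^esub> v = \<zero>\<^bsub>B\<^esub>"
  using B.r_neg[of "u \<oplus>\<^bsub>B\<^esub> v"] by (simp add: a_minus_def B.minus_add B.a_assoc)

lemma formal_mult_rel: "r \<in> Rel \<Longrightarrow> formal_mult r = \<zero>\<^bsub>B\<^esub>"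
proof -
  have *: "formal_mult (frag_of p - frag_of q) = formal_mult (frag_of p) \<ominus>\<^bsub>B\<^esub> formal_mult (frag_of q)"
     "s \<in> carrier B \<times> carrier B \<Longrightarrow> 
      formal_mult (frag_of p - frag_of q - frag_of s) = formal_mult (frag_of p) \<ominus>\<^bsub>B\<^esub> formal_mult (frag_of q) \<ominus>\<^bsub>B\<^esub> formal_mult (frag_of s)"
    if "p \<in> carrier B \<times> carrier B" "q \<in> carrier B \<times> carrier B" for p q s
  proof -
    show "formal_mult (frag_of p - frag_of q) = formal_mult (frag_of p) \<ominus>\<^bsub>B\<^esub> formal_mult (frag_of q)"
      by (rule formal_mult_diff) (use that in auto)
    then show "s \<in> carrier B \<times> carrier B \<Longrightarrow> 
      formal_mult (frag_of p - frag_of q - frag_of s) = formal_mult (frag_of p) \<ominus>\<^bsub>B\<^esub> formal_mult (frag_of q) \<ominus>\<^bsub>B\<^esub> formal_mult (frag_of s)"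
      using formal_mult_diff[of "frag_of p - frag_of q" "frag_of s"] keys_diffI[of "frag_of p" "carrier B \<times> carrier B" "frag_of q"] that by auto
  qed
  assume "r \<in> Rel"
  then show ?thesis
    unfolding tensor_relators_def
  proof (elim UnE CollectE exE conjE; hypsubst)
    fix x x' y assume "x \<in> carrier B" "x' \<in> carrier B" "y \<in> carrier B"
    then show "formal_mult (frag_of (x \<oplus>\<^bsub>B\<^esub> x', y) - frag_of (x, y) - frag_of (x', y)) = \<zero>\<^bsub>B\<^esub>"
      by (subst *) (auto simp: formal_mult_of B.l_distr cancel2)
  next
    fix x x' y assume "x \<in> carrier B" "x' \<in> carrier B" "y \<in> carrier B"
    then show "formal_mult (frag_of (x, x' \<oplus>\<^bsub>B\<^esub> y) - frag_of (x, x') - frag_of (x, y)) = \<zero>\<^bsub>B\<^esub>"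
      by (subst *) (auto simp: formal_mult_of B.r_distr cancel2)
  next
    fix x a y assume "x \<in> carrier B" "a \<in> carrier A" "y \<in> carrier B"
    then show "formal_mult (frag_of (x \<otimes>\<^bsub>B\<^esub> \<phi> a, y) - frag_of (x, \<phi> a \<otimes>\<^bsub>B\<^esub> y)) = \<zero>\<^bsub>B\<^esub>"
      by (subst *) (auto simp: formal_mult_of B.m_assoc a_minus_def B.r_neg)
  qed
qed

lemma formal_mult_null: "n \<in> Null \<Longrightarrow> formal_mult n = \<zero>\<^bsub>B\<^esub>"
proof -
  assume "n \<in> Null"
  then have "Poly_Mapping.keys n \<subseteq> carrier B \<times> carrier B \<and> formal_mult n = \<zero>\<^bsub>B\<^esub>"
    unfolding tensor_null_def
  proof (induction rule: generate.induct)
    case (inv h)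
    show ?case unfolding inv_free_Abelian_group[OF keys_relators[OF inv]] formal_mult_minus[OF keys_relators[OF inv]] formal_mult_rel[OF inv]
      using keys_relators[OF inv] by (simp add: keys_minus)
  next case (eng a b) then show ?case by (auto simp: formal_mult_add keys_sumI)
  qed (use keys_relators formal_mult_rel in auto)
  then show ?thesis ..
qed

lemma tensor_mult_coset:
  assumes "Poly_Mapping.keys c \<subseteq> carrier B \<times> carrier B"
  shows "tensor_mult B (Null #>\<^bsub>Free\<^esub> c) = formal_mult c"
proof -
  have "0 \<in> Null" using subgroup.one_closed[OF tensor_null_subgroup] by simp
  then have "c \<in> Null #>\<^bsub>Free\<^esub> c" unfolding in_coset_iff[OF assms] by (intro bexI[of _ 0]) simp
  moreover have "formal_mult c' = formal_mult c" if c': "c' \<in> Null #>\<^bsub>Free\<^esub> c" for c'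
  proof -
    obtain n where n: "n \<in> Null" "c' = n + c" using c' unfolding in_coset_iff[OF assms] by blast
    show ?thesis unfolding n(2) formal_mult_add[OF tensor_null_carrier[OF n(1)] assms] formal_mult_null[OF n(1)]
      by (rule B.l_zero[OF formal_mult_closed[OF assms]])
  qed
  ultimately have "(\<lambda>c. formal_mult c) ` (Null #>\<^bsub>Free\<^esub> c) = {formal_mult c}" by blast
  then show ?thesis unfolding tensor_mult_def by simp
qed

lemma tensor_mult_pure_tensor: "x \<in> carrier B \<Longrightarrow> y \<in> carrier B \<Longrightarrow> tensor_mult B (pure_tensor A B \<phi> x y) = x \<otimes>\<^bsub>B\<^esub> y"
  unfolding pure_tensor_def by (subst tensor_mult_coset) (auto simp: formal_mult_of)

end

end

theory Submission
  imports Defs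
begin

text \<open>
  A homomorphism \<open>\<rho> : B \<rightarrow> B \<otimes>\<^sub>A B\<close> of left \<open>B\<close>-modules is determined by \<open>\<omega> = \<rho> 1\<close>, as
  \<open>\<rho> b = b \<omega>\<close>, and each property of a splitting translates into one of \<open>\<omega>\<close>. Right linearity of
  \<open>\<rho>\<close> says that \<open>b \<omega> = \<omega> b\<close>; the grading is respected when \<open>\<omega>\<close> has degree \<open>0\<close>, because \<open>1\<close> has
  degree \<open>0\<close> and \<open>B\<^sub>m (B \<otimes>\<^sub>A B)\<^sub>n \<subseteq> (B \<otimes>\<^sub>A B)\<^sub>m\<^sub>+\<^sub>n\<close>; and \<open>\<mu> \<circ> \<rho> = id\<close> says that \<open>\<mu> \<omega> = 1\<close>, as
  \<open>\<mu> (b \<omega>) = b (\<mu> \<omega>)\<close>.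

  For the differential, \<open>d 1 = 0\<close> by the Leibniz rule, whence \<open>d \<omega> = \<rho> (d 1) = 0\<close>. Conversely, the
  Leibniz rule \<open>d (b t) = (d b) t + \<epsilon>(b) (d t)\<close> for the left action, \<open>\<epsilon>\<close> being the grading
  involution, gives \<open>d (b \<omega>) = (d b) \<omega>\<close> as soon as \<open>d \<omega> = 0\<close>.

  What this uses about \<open>B \<otimes>\<^sub>A B\<close> is that the left action is biadditive, associative, \<open>K\<close>-linear and
  commutes with the right action, together with its Leibniz rule (\<open>tensor_leibniz_left\<close>), its degree
  (\<open>lact_grade\<close>) and the left linearity of \<open>\<mu>\<close>. The identities among these are between additive maps, so
  they follow from the case of pure tensors (\<open>tensor_induct\<close>). The two directions are
  \<open>splitting_imp_separability_element\<close> and \<open>separability_element_hom\<close>.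
\<close>

section \<open>The unit is a cycle\<close>

context dg_algebra
begin

lemma diff_one: "diff A \<one>\<^bsub>A\<^esub> = \<zero>\<^bsub>A\<^esub>"
proof -
  have "diff A \<one>\<^bsub>A\<^esub> = diff A (\<one>\<^bsub>A\<^esub> \<otimes>\<^bsub>A\<^esub> \<one>\<^bsub>A\<^esub>)" by simp
  also have "\<dots> = diff A \<one>\<^bsub>A\<^esub> \<oplus>\<^bsub>A\<^esub> diff A \<one>\<^bsub>A\<^esub>"
    unfolding leibniz[OF grade_one grade_one] by (simp add: koszul_sign_def diff_closed)
  finally show ?thesis
    using add.l_cancel_one'[OF diff_closed[OF one_closed] diff_closed[OF one_closed]] by simp
qed

end

section \<open>The tensor product as a sum of pure tensors\<close>

context dg_extension
begin

abbreviation (input) "BB \<equiv> tensor_dg_bimodule A B \<phi>"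
abbreviation pure (infixl "\<boxtimes>" 71) where "x \<boxtimes> y \<equiv> pure_tensor A B \<phi> x y"

lemma tensor_carrier: "carrier BB = carrier (tensor_group A B \<phi>)"
  and tensor_add: "ring.add BB = monoid.mult (tensor_group A B \<phi>)"
  and tensor_zero: "\<zero>\<^bsub>BB\<^esub> = \<one>\<^bsub>tensor_group A B \<phi>\<^esub>"
  by (simp_all add: tensor_dg_bimodule_def)

lemma tensor_group_comm: "comm_group (tensor_group A B \<phi>)"
  unfolding tensor_group_def
  by (rule comm_group.abelian_FactGroup[OF abelian_free_Abelian_group tensor_null_subgroup])

lemma tensor_abelian_group: "abelian_group BB"
proof -
  interpret comm_group "tensor_group A B \<phi>" by (rule tensor_group_comm)
  show ?thesis
    by (rule abelian_groupI) (auto simp: tensor_carrier tensor_add tensor_zero m_ac intro: l_inv_ex)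
qed

sublocale BB: abelian_group BB by (rule tensor_abelian_group)

lemma tensor_a_inv: "\<ominus>\<^bsub>BB\<^esub> t = inv\<^bsub>tensor_group A B \<phi>\<^esub> t"
  by (simp add: a_inv_def m_inv_def tensor_carrier tensor_add tensor_zero)

lemma pure_closed: "x \<in> carrier B \<Longrightarrow> y \<in> carrier B \<Longrightarrow> x \<boxtimes> y \<in> carrier BB"
  by (simp add: tensor_carrier pure_tensor_closed)

lemma tensor_carrierE:
  assumes "t \<in> carrier BB"
  obtains c where "Poly_Mapping.keys c \<subseteq> carrier B \<times> carrier B" "t = Null #>\<^bsub>Free\<^esub> c"
  using assms by (auto simp: tensor_carrier tensor_group_def carrier_FactGroup)

lemma coset_closed:
  "Poly_Mapping.keys c \<subseteq> carrier B \<times> carrier B \<Longrightarrow> Null #>\<^bsub>Free\<^esub> c \<in> carrier BB"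
  by (auto simp: tensor_carrier tensor_group_def carrier_FactGroup)

lemma coset_zero: "Null #>\<^bsub>Free\<^esub> 0 = \<zero>\<^bsub>BB\<^esub>"
  using coset_closed[of 0] add_coset[of 0 0] by (simp add: BB.add.l_cancel_one')

lemma coset_eqI:
  assumes "c - e \<in> Null" "Poly_Mapping.keys e \<subseteq> carrier B \<times> carrier B"
  shows "Null #>\<^bsub>Free\<^esub> c = Null #>\<^bsub>Free\<^esub> e"
  using coset_absorb[OF assms] by simp

lemma pure_add_left:
  assumes "x \<in> carrier B" "x' \<in> carrier B" "y \<in> carrier B"
  shows "(x \<oplus>\<^bsub>B\<^esub> x') \<boxtimes> y = x \<boxtimes> y \<oplus>\<^bsub>BB\<^esub> x' \<boxtimes> y"
proof -
  have "Null #>\<^bsub>Free\<^esub> frag_of (x \<oplus>\<^bsub>B\<^esub> x', y) = Null #>\<^bsub>Free\<^esub> (frag_of (x, y) + frag_of (x', y))"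
    using assms null_l[OF assms] by (intro coset_eqI keys_sumI) (auto simp: algebra_simps)
  then show ?thesis using assms by (simp add: pure_tensor_def add_coset)
qed

lemma pure_minus_left:
  assumes "x \<in> carrier B" "y \<in> carrier B"
  shows "(\<ominus>\<^bsub>B\<^esub> x) \<boxtimes> y = \<ominus>\<^bsub>BB\<^esub> (x \<boxtimes> y)"
proof -
  have z: "\<zero>\<^bsub>B\<^esub> \<boxtimes> y = \<zero>\<^bsub>BB\<^esub>"
    using pure_add_left[of "\<zero>\<^bsub>B\<^esub>" "\<zero>\<^bsub>B\<^esub>" y] pure_closed[of "\<zero>\<^bsub>B\<^esub>" y] assms
    by (metis B.l_zero B.zero_closed BB.add.l_cancel_one')
  have "(\<ominus>\<^bsub>B\<^esub> x) \<boxtimes> y \<oplus>\<^bsub>BB\<^esub> x \<boxtimes> y = \<zero>\<^bsub>BB\<^esub>"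
    using pure_add_left[of "\<ominus>\<^bsub>B\<^esub> x" x y] assms z by (simp add: B.l_neg)
  then show ?thesis
    using BB.minus_equality[of "(\<ominus>\<^bsub>B\<^esub> x) \<boxtimes> y" "x \<boxtimes> y"] assms by (simp add: pure_closed)
qed

text \<open>
  Negatives need no case of their own because \<open>- (x \<boxtimes> y) = (- x) \<boxtimes> y\<close> is again a pure tensor. In the
  induction over formal sums, \<open>P\<close> is therefore carried along for a sum and its negative together.
\<close>

lemma tensor_induct [consumes 1, case_names pure add]:
  assumes t: "t \<in> carrier BB"
    and pure: "\<And>x y. \<lbrakk>x \<in> carrier B; y \<in> carrier B\<rbrakk> \<Longrightarrow> P (x \<boxtimes> y)"
    and add: "\<And>s t. \<lbrakk>s \<in> carrier BB; t \<in> carrier BB; P s; P t\<rbrakk> \<Longrightarrow> P (s \<oplus>\<^bsub>BB\<^esub> t)"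
  shows "P t"
proof -
  let ?C = "\<lambda>c. Null #>\<^bsub>Free\<^esub> c"
  obtain c where c: "Poly_Mapping.keys c \<subseteq> carrier B \<times> carrier B" "t = ?C c"
    using t by (rule tensor_carrierE)
  \<comment> \<open>The empty sum is written as \<open>0 \<boxtimes> 0 + (- 0) \<boxtimes> 0\<close>, as \<open>P\<close> is known only for sums of pure tensors.\<close>
  have P_zero: "P (?C 0)"
  proof -
    have "(\<zero>\<^bsub>B\<^esub> \<boxtimes> \<zero>\<^bsub>B\<^esub>) \<oplus>\<^bsub>BB\<^esub> ((\<ominus>\<^bsub>B\<^esub> \<zero>\<^bsub>B\<^esub>) \<boxtimes> \<zero>\<^bsub>B\<^esub>) = \<zero>\<^bsub>BB\<^esub>"
      using pure_closed[of "\<zero>\<^bsub>B\<^esub>" "\<zero>\<^bsub>B\<^esub>"] by (simp only: pure_minus_left B.zero_closed BB.r_neg)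
    then have "P \<zero>\<^bsub>BB\<^esub>"
      using add[OF _ _ pure pure, of "\<zero>\<^bsub>B\<^esub>" "\<zero>\<^bsub>B\<^esub>" "\<ominus>\<^bsub>B\<^esub> \<zero>\<^bsub>B\<^esub>" "\<zero>\<^bsub>B\<^esub>"]
      by (simp add: pure_closed)
    then show ?thesis by (simp only: coset_zero)
  qed
  have "Poly_Mapping.keys c \<subseteq> carrier B \<times> carrier B \<and> P (?C c) \<and> P (?C (- c))"
    using c(1)
  proof (induction c rule: frag_induction)
    case zero
    then show ?case using P_zero by simp
  next
    case (one p)
    then obtain x y where p: "p = (x, y)" "x \<in> carrier B" "y \<in> carrier B" by auto
    have k: "Poly_Mapping.keys (- frag_of p) \<subseteq> carrier B \<times> carrier B"
      using one by (simp add: keys_minus)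
    have "?C (- frag_of p) \<oplus>\<^bsub>BB\<^esub> ?C (frag_of p) = \<zero>\<^bsub>BB\<^esub>"
      using add_coset[OF k, of "frag_of p"] one by (simp add: coset_zero)
    then have "?C (- frag_of p) = \<ominus>\<^bsub>BB\<^esub> (x \<boxtimes> y)"
      using BB.minus_equality[of "?C (- frag_of p)" "?C (frag_of p)"] coset_closed[OF k] coset_closed[of "frag_of p"] one p
      by (simp add: pure_tensor_def)
    then have "?C (- frag_of p) = (\<ominus>\<^bsub>B\<^esub> x) \<boxtimes> y" using p by (simp add: pure_minus_left)
    then show ?case
      using one p pure[of x y] pure[of "\<ominus>\<^bsub>B\<^esub> x" y] by (simp add: pure_tensor_def)
  next
    case (diff a b)
    have k: "Poly_Mapping.keys (- a) \<subseteq> carrier B \<times> carrier B" "Poly_Mapping.keys (- b) \<subseteq> carrier B \<times> carrier B"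
      using diff by (simp_all add: keys_minus)
    have "P (?C (a + - b))" "P (?C (b + - a))"
      using diff k by (simp_all only: add_coset[symmetric]; blast intro: add coset_closed)+
    moreover have "Poly_Mapping.keys (a - b) \<subseteq> carrier B \<times> carrier B"
      using diff by (intro keys_diffI) auto
    ultimately show ?case by simp
  qed
  then show ?thesis using c by simp
qed

section \<open>Additivity of the operations\<close>

text \<open>The two actions, the scalar multiplication and the differential all have the shape assumed here.\<close>

lemma coset_map_additive:
  assumes F: "\<And>c. Poly_Mapping.keys c \<subseteq> carrier B \<times> carrier B \<Longrightarrow>
      F (Null #>\<^bsub>Free\<^esub> c) = Null #>\<^bsub>Free\<^esub> frag_extend f c"
    and f: "\<And>x y. \<lbrakk>x \<in> carrier B; y \<in> carrier B\<rbrakk> \<Longrightarrow>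
      Poly_Mapping.keys (f (x, y)) \<subseteq> carrier B \<times> carrier B"
  shows "abelian_group_hom BB BB F"
proof -
  have k: "Poly_Mapping.keys (frag_extend f c) \<subseteq> carrier B \<times> carrier B"
    if "Poly_Mapping.keys c \<subseteq> carrier B \<times> carrier B" for c
  proof (rule subset_trans[OF keys_frag_extend], rule UN_least)
    show "Poly_Mapping.keys (f p) \<subseteq> carrier B \<times> carrier B" if "p \<in> Poly_Mapping.keys c" for p
      using f[of "fst p" "snd p"] subsetD[OF \<open>Poly_Mapping.keys c \<subseteq> _\<close> that]
      by (simp only: mem_Times_iff prod.collapse)
  qed
  have "F t \<in> carrier BB" if "t \<in> carrier BB" for t
    using that by (rule tensor_carrierE) (simp only: F k coset_closed)
  moreover have "F (s \<oplus>\<^bsub>BB\<^esub> t) = F s \<oplus>\<^bsub>BB\<^esub> F t" if s: "s \<in> carrier BB" and t: "t \<in> carrier BB" for s t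
  proof -
    obtain c where c: "Poly_Mapping.keys c \<subseteq> carrier B \<times> carrier B" "s = Null #>\<^bsub>Free\<^esub> c"
      using s by (rule tensor_carrierE)
    obtain e where e: "Poly_Mapping.keys e \<subseteq> carrier B \<times> carrier B" "t = Null #>\<^bsub>Free\<^esub> e"
      using t by (rule tensor_carrierE)
    show ?thesis
      unfolding c(2) e(2) add_coset[OF c(1) e(1)] F[OF c(1)] F[OF e(1)] F[OF keys_sumI[OF c(1) e(1)]]
        add_coset[OF k[OF c(1)] k[OF e(1)]] frag_extend_add ..
  qed
  ultimately show ?thesis
    by (intro abelian_group_homI group_hom.intro group_hom_axioms.intro tensor_abelian_group
        BB.a_group) (simp add: hom_def)
qed

lemma lact_hom: "b \<in> carrier B \<Longrightarrow> abelian_group_hom BB BB (lact BB b)"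
  by (rule coset_map_additive[OF lact_coset]) auto

lemma ract_hom: "b \<in> carrier B \<Longrightarrow> abelian_group_hom BB BB (\<lambda>t. ract BB t b)"
  by (rule coset_map_additive[OF ract_coset]) auto

lemma smult_hom: "k \<in> carrier K \<Longrightarrow> abelian_group_hom BB BB (\<lambda>t. k \<odot>\<^bsub>BB\<^esub> t)"
  by (rule coset_map_additive[OF smult_coset]) auto

lemma diff_hom: "abelian_group_hom BB BB (diff BB)"
  by (rule coset_map_additive[OF diff_coset], assumption, unfold prod.case, rule keys_sumI)
    (auto simp: B.diff_closed B.invol_closed)

lemma tensor_mult_closed: "t \<in> carrier BB \<Longrightarrow> tensor_mult B t \<in> carrier B"
  by (erule tensor_carrierE) (simp only: tensor_mult_coset formal_mult_closed)

lemma tensor_mult_add: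
  assumes s: "s \<in> carrier BB" and t: "t \<in> carrier BB"
  shows "tensor_mult B (s \<oplus>\<^bsub>BB\<^esub> t) = tensor_mult B s \<oplus>\<^bsub>B\<^esub> tensor_mult B t"
proof -
  obtain c where c: "Poly_Mapping.keys c \<subseteq> carrier B \<times> carrier B" "s = Null #>\<^bsub>Free\<^esub> c"
    using s by (rule tensor_carrierE)
  obtain e where e: "Poly_Mapping.keys e \<subseteq> carrier B \<times> carrier B" "t = Null #>\<^bsub>Free\<^esub> e"
    using t by (rule tensor_carrierE)
  show ?thesis
    unfolding c(2) e(2) add_coset[OF c(1) e(1)] tensor_mult_coset[OF c(1)] tensor_mult_coset[OF e(1)]
      tensor_mult_coset[OF keys_sumI[OF c(1) e(1)]] by (rule formal_mult_add[OF c(1) e(1)])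
qed

lemmas lact_closed = abelian_group_hom.hom_closed[OF lact_hom]
  and lact_add = abelian_group_hom.hom_add[OF lact_hom]
  and lact_zero = abelian_group_hom.hom_zero[OF lact_hom]
  and ract_closed = abelian_group_hom.hom_closed[OF ract_hom]
  and ract_add = abelian_group_hom.hom_add[OF ract_hom]
  and smult_add = abelian_group_hom.hom_add[OF smult_hom]
  and tensor_diff_closed = abelian_group_hom.hom_closed[OF diff_hom]
  and tensor_diff_add = abelian_group_hom.hom_add[OF diff_hom]

section \<open>Bimodule identities\<close>

lemma lact_add_left:
  assumes "t \<in> carrier BB" "b \<in> carrier B" "c \<in> carrier B"
  shows "lact BB (b \<oplus>\<^bsub>B\<^esub> c) t = lact BB b t \<oplus>\<^bsub>BB\<^esub> lact BB c t"
  using assms(1)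
proof (induction rule: tensor_induct)
  case (pure x y)
  then show ?case using assms by (simp add: lact_pure_tensor B.l_distr pure_add_left)
next
  case (add s t)
  then show ?case using assms by (simp add: lact_add lact_closed BB.a_ac)
qed

lemma lact_smult:
  assumes "t \<in> carrier BB" "k \<in> carrier K" "b \<in> carrier B"
  shows "lact BB (k \<odot>\<^bsub>B\<^esub> b) t = k \<odot>\<^bsub>BB\<^esub> lact BB b t"
  using assms(1)
proof (induction rule: tensor_induct)
  case (pure x y)
  then show ?case using assms by (simp add: lact_pure_tensor smult_pure_tensor B.smult_mult_left)
next
  case (add s t)
  then show ?case using assms by (simp add: lact_add lact_closed smult_add)
qed

lemma lact_mult:
  assumes "t \<in> carrier BB" "b \<in> carrier B" "c \<in> carrier B"
  shows "lact BB (b \<otimes>\<^bsub>B\<^esub> c) t = lact BB b (lact BB c t)"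
  using assms(1)
proof (induction rule: tensor_induct)
  case (pure x y)
  then show ?case using assms by (simp add: lact_pure_tensor B.m_assoc)
next
  case (add s t)
  then show ?case using assms by (simp add: lact_add lact_closed)
qed

lemma lact_ract:
  assumes "t \<in> carrier BB" "b \<in> carrier B" "c \<in> carrier B"
  shows "lact BB b (ract BB t c) = ract BB (lact BB b t) c"
  using assms(1)
proof (induction rule: tensor_induct)
  case (pure x y)
  then show ?case using assms by (simp add: lact_pure_tensor ract_pure_tensor)
next
  case (add s t)
  then show ?case using assms by (simp add: lact_add ract_add lact_closed ract_closed)
qed

lemma tensor_mult_lact:
  assumes "t \<in> carrier BB" "b \<in> carrier B"
  shows "tensor_mult B (lact BB b t) = b \<otimes>\<^bsub>B\<^esub> tensor_mult B t"
  using assms(1)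
proof (induction rule: tensor_induct)
  case (pure x y)
  then show ?case using assms by (simp add: lact_pure_tensor tensor_mult_pure_tensor B.m_assoc)
next
  case (add s t)
  then show ?case
    using assms by (simp add: lact_add lact_closed tensor_mult_add tensor_mult_closed B.r_distr)
qed

section \<open>Compatibility with the differential and the grading\<close>

lemma diff_pure:
  assumes "x \<in> carrier B" "y \<in> carrier B"
  shows "diff BB (x \<boxtimes> y) = diff B x \<boxtimes> y \<oplus>\<^bsub>BB\<^esub> grading_involution B x \<boxtimes> diff B y"
  using assms unfolding pure_tensor_def
  by (simp add: diff_coset add_coset B.diff_closed B.invol_closed)

text \<open>
  Because \<open>\<epsilon>\<close> is multiplicative, the terms of \<open>d (b x \<boxtimes> y)\<close> regroup:
  \<open>d (b x) \<boxtimes> y + \<epsilon> (b x) \<boxtimes> d y = d b x \<boxtimes> y + \<epsilon> b (d x \<boxtimes> y + \<epsilon> x \<boxtimes> d y)\<close>.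
\<close>

lemma tensor_leibniz_left:
  assumes "t \<in> carrier BB" "b \<in> carrier B"
  shows "diff BB (lact BB b t) =
    lact BB (diff B b) t \<oplus>\<^bsub>BB\<^esub> lact BB (grading_involution B b) (diff BB t)"
  using assms(1)
proof (induction rule: tensor_induct)
  case (pure x y)
  then show ?case
    using assms
    by (simp add: lact_pure_tensor diff_pure B.leibniz' B.invol_mult pure_add_left lact_add
        pure_closed B.diff_closed B.invol_closed BB.a_assoc)
next
  case (add s t)
  then show ?case
    using assms
    by (simp add: lact_add lact_closed tensor_diff_add tensor_diff_closed B.diff_closed
        B.invol_closed BB.a_ac)
qed

lemma tensor_grade:
  "grade BB n = generate (tensor_group A B \<phi>)
    {x \<boxtimes> y | x y i j. x \<in> grade B i \<and> y \<in> grade B j \<and> i + j = n}"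
  by (simp add: tensor_dg_bimodule_def)

lemma grade_pure:
  "\<lbrakk>x \<in> grade B i; y \<in> grade B j\<rbrakk> \<Longrightarrow> x \<boxtimes> y \<in> grade BB (i + j)"
  unfolding tensor_grade by (rule generate.incl) blast

text \<open>
  As \<open>- (x \<boxtimes> y) = (- x) \<boxtimes> y\<close>, inverses of the generators of a graded piece are again pure tensors of
  the same degree. Membership in the carrier is proved along with the claim because additivity of the
  action needs it in the induction step.
\<close>

lemma lact_grade:
  assumes b: "b \<in> grade B m" and t: "t \<in> grade BB n"
  shows "lact BB b t \<in> grade BB (m + n)"
proof -
  interpret G: comm_group "tensor_group A B \<phi>" by (rule tensor_group_comm)
  have bc: "b \<in> carrier B" by (rule B.grade_carrier[OF b])
  have pure: "lact BB b (x \<boxtimes> y) \<in> grade BB (m + n)"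
    if "x \<in> grade B i" "y \<in> grade B j" "i + j = n" for x y i j
    using grade_pure[OF B.grade_mult[OF b that(1)] that(2)] that bc
    by (simp add: lact_pure_tensor B.grade_carrier add.assoc)
  have "t \<in> carrier BB \<and> lact BB b t \<in> grade BB (m + n)"
    using t unfolding tensor_grade[of n]
  proof (induction rule: generate.induct)
    case one
    show ?case
      using lact_zero[OF bc] generate.one[of "tensor_group A B \<phi>"] BB.zero_closed
      by (simp add: tensor_zero tensor_grade)
  next
    case (incl h)
    then show ?case using pure by (auto intro!: pure_closed B.grade_carrier)
  next
    case (inv h)
    then obtain x y i j where h: "h = x \<boxtimes> y" "x \<in> grade B i" "y \<in> grade B j" "i + j = n" by blast
    have "inv\<^bsub>tensor_group A B \<phi>\<^esub> h = (\<ominus>\<^bsub>B\<^esub> x) \<boxtimes> y"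
      using h by (simp add: tensor_a_inv[symmetric] pure_minus_left B.grade_carrier)
    moreover have "\<ominus>\<^bsub>B\<^esub> x \<in> grade B i"
      by (rule B.submoduleE(3)[OF B.grade_submodule h(2)])
    ultimately show ?case
      using pure h by (auto intro!: pure_closed B.grade_carrier)
  next
    case (eng s t)
    then have st: "s \<in> carrier BB" "t \<in> carrier BB" by auto
    have "lact BB b s \<otimes>\<^bsub>tensor_group A B \<phi>\<^esub> lact BB b t \<in> grade BB (m + n)"
      using eng.IH unfolding tensor_grade by (blast intro: generate.eng)
    then show ?case
      using lact_add[OF bc st] BB.add.m_closed[OF st] by (simp add: tensor_add)
  qed
  then show ?thesis ..
qed

section \<open>Splittings and separability elements\<close>

text \<open>
  Centrality comes from evaluating \<open>\<rho>\<close> at \<open>b 1 = 1 b\<close>, using left linearity for one side and right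
  linearity for the other.
\<close>

lemma splitting_imp_separability_element:
  assumes \<rho>: "\<rho> \<in> dg_bimodule_hom K B (regular_dg_bimodule B) BB"
    and split: "\<And>b. b \<in> carrier B \<Longrightarrow> tensor_mult B (\<rho> b) = b"
  shows "\<rho> \<one>\<^bsub>B\<^esub> \<in> a_kernel BB BB (diff BB)" "\<rho> \<one>\<^bsub>B\<^esub> \<in> grade BB 0"
    and "\<And>b. b \<in> carrier B \<Longrightarrow> lact BB b (\<rho> \<one>\<^bsub>B\<^esub>) = ract BB (\<rho> \<one>\<^bsub>B\<^esub>) b"
    and "tensor_mult B (\<rho> \<one>\<^bsub>B\<^esub>) = \<one>\<^bsub>B\<^esub>"
proof -
  have closed: "\<And>b. b \<in> carrier B \<Longrightarrow> \<rho> b \<in> carrier BB"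
    and add: "\<And>b c. \<lbrakk>b \<in> carrier B; c \<in> carrier B\<rbrakk> \<Longrightarrow> \<rho> (b \<oplus>\<^bsub>B\<^esub> c) = \<rho> b \<oplus>\<^bsub>BB\<^esub> \<rho> c"
    and left: "\<And>b c. \<lbrakk>b \<in> carrier B; c \<in> carrier B\<rbrakk> \<Longrightarrow> \<rho> (b \<otimes>\<^bsub>B\<^esub> c) = lact BB b (\<rho> c)"
    and right: "\<And>b c. \<lbrakk>b \<in> carrier B; c \<in> carrier B\<rbrakk> \<Longrightarrow> \<rho> (b \<otimes>\<^bsub>B\<^esub> c) = ract BB (\<rho> b) c"
    and graded: "\<And>b n. b \<in> grade B n \<Longrightarrow> \<rho> b \<in> grade BB n"
    and diff: "\<And>b. b \<in> carrier B \<Longrightarrow> \<rho> (diff B b) = diff BB (\<rho> b)"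
    using \<rho> unfolding dg_bimodule_hom_def regular_dg_bimodule_def by auto
  have "\<rho> \<zero>\<^bsub>B\<^esub> = \<zero>\<^bsub>BB\<^esub>"
    using add[of "\<zero>\<^bsub>B\<^esub>" "\<zero>\<^bsub>B\<^esub>"] closed[of "\<zero>\<^bsub>B\<^esub>"] by (simp add: BB.add.l_cancel_one')
  then show "\<rho> \<one>\<^bsub>B\<^esub> \<in> a_kernel BB BB (diff BB)"
    using diff[of "\<one>\<^bsub>B\<^esub>"] closed[of "\<one>\<^bsub>B\<^esub>"] by (simp add: a_kernel_def' B.diff_one)
  show "\<rho> \<one>\<^bsub>B\<^esub> \<in> grade BB 0" by (rule graded[OF B.grade_one])
  show "lact BB b (\<rho> \<one>\<^bsub>B\<^esub>) = ract BB (\<rho> \<one>\<^bsub>B\<^esub>) b" if "b \<in> carrier B" for b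
    using left[OF that B.one_closed] right[OF B.one_closed that] that by simp
  show "tensor_mult B (\<rho> \<one>\<^bsub>B\<^esub>) = \<one>\<^bsub>B\<^esub>" by (rule split) simp
qed

text \<open>
  Conversely, left multiplication into a central cycle of degree \<open>0\<close> is a morphism of dg-bimodules. Right
  linearity is the chain \<open>(x b) \<omega> = x (b \<omega>) = x (\<omega> b) = (x \<omega>) b\<close>.
\<close>

lemma separability_element_hom:
  assumes \<omega>: "\<omega> \<in> carrier BB" "diff BB \<omega> = \<zero>\<^bsub>BB\<^esub>" "\<omega> \<in> grade BB 0"
    and central: "\<And>b. b \<in> carrier B \<Longrightarrow> lact BB b \<omega> = ract BB \<omega> b"
  shows "(\<lambda>b. lact BB b \<omega>) \<in> dg_bimodule_hom K B (regular_dg_bimodule B) BB"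
proof -
  have right: "ract BB (lact BB x \<omega>) b = lact BB x (lact BB b \<omega>)"
    if "x \<in> carrier B" "b \<in> carrier B" for x b
    using that \<omega> by (simp add: central[OF that(2)] lact_ract)
  have diff: "lact BB (diff B x) \<omega> = diff BB (lact BB x \<omega>)" if "x \<in> carrier B" for x
    using that \<omega>
    by (simp add: tensor_leibniz_left lact_zero lact_closed B.diff_closed B.invol_closed)
  have graded: "lact BB x \<omega> \<in> grade BB n" if "x \<in> grade B n" for x n
    using lact_grade[OF that \<omega>(3)] by simp
  show ?thesis
    unfolding dg_bimodule_hom_def regular_dg_bimodule_def
    using \<omega> by (auto simp: lact_closed lact_add_left lact_smult lact_mult right diff graded)
qed

end

theorem proposition2p3:
  fixes K :: "('k, 'r) ring_scheme"
    and A :: "('k, 'a, 'm) dg_module_scheme"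
    and B :: "('k, 'b, 'n) dg_module_scheme"
    and \<phi> :: "'a \<Rightarrow> 'b"
  assumes "dg_extension K A B \<phi>"
  defines "T \<equiv> tensor_dg_bimodule A B \<phi>"
  shows "dg_separable K A B \<phi> \<longleftrightarrow>
    (\<exists>\<omega> \<in> a_kernel T T (diff T).
       \<omega> \<in> grade T 0 \<and>
       (\<forall>b\<in>carrier B. lact T b \<omega> = ract T \<omega> b) \<and>
       tensor_mult B \<omega> = \<one>\<^bsub>B\<^esub>)"
proof -
  interpret dg_extension K A B \<phi> by fact
  show ?thesis
  proof
    assume "dg_separable K A B \<phi>"
    then obtain \<rho> where \<rho>: "\<rho> \<in> dg_bimodule_hom K B (regular_dg_bimodule B) T"
      "\<And>b. b \<in> carrier B \<Longrightarrow> tensor_mult B (\<rho> b) = b"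
      unfolding dg_separable_def T_def by blast
    show "\<exists>\<omega> \<in> a_kernel T T (diff T). \<omega> \<in> grade T 0 \<and>
       (\<forall>b\<in>carrier B. lact T b \<omega> = ract T \<omega> b) \<and> tensor_mult B \<omega> = \<one>\<^bsub>B\<^esub>"
      using splitting_imp_separability_element[OF \<rho>[unfolded T_def]] unfolding T_def by blast
  next
    assume "\<exists>\<omega> \<in> a_kernel T T (diff T). \<omega> \<in> grade T 0 \<and>
       (\<forall>b\<in>carrier B. lact T b \<omega> = ract T \<omega> b) \<and> tensor_mult B \<omega> = \<one>\<^bsub>B\<^esub>"
    then obtain \<omega> where \<omega>: "\<omega> \<in> carrier T" "diff T \<omega> = \<zero>\<^bsub>T\<^esub>" "\<omega> \<in> grade T 0"
      "\<And>b. b \<in> carrier B \<Longrightarrow> lact T b \<omega> = ract T \<omega> b" "tensor_mult B \<omega> = \<one>\<^bsub>B\<^esub>"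
      by (auto simp: a_kernel_def')
    have "tensor_mult B (lact T b \<omega>) = b" if "b \<in> carrier B" for b
      using that \<omega>(1,5) unfolding T_def by (simp add: tensor_mult_lact)
    then show "dg_separable K A B \<phi>"
      unfolding dg_separable_def T_def
      by (intro bexI[OF _ separability_element_hom[OF \<omega>(1-4)[unfolded T_def]]] ballI)
  qed
qed

end
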